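(* For every integer $d\ge 1$, $w_2(d)<73$.
   Context: $C([0,1]^d)$ denotes the space of all continuous real-valued functions on the unit cube $[0,1]^d$. A linear polynomial in $d$ variables is a real polynomial of total degree $\le 1$ (i.e., an affine function). The constant $w_2(d)$ is the smallest constant such that for every $f\in C([0,1]^d)$ $$\min_{L}\max_{x\in[0,1]^d}|f(x)-L(x)|\le w_2(d)\max_{x,y\in[0,1]^d}\left|f(x)+f(y)-2f\left(\tfrac{x+y}{2}\right)\right|,$$ where the minimum is taken over all linear polynomials $L$ in $d$ variables. *)

theory Defs
  imports "HOL-Analysis.Analysis"
begin

text \<open>The dimension \<open>d\<close> is the cardinality of the finite index type \<open>'n\<close>. The maxima and the minimum
  of the definition are written as suprema and an infimum of real numbers: the maxima are attained
  by continuity and compactness, the minimum because the space of linear polynomials has finite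
  dimension.\<close>

definition unit_cube :: "(real ^ 'n::finite) set" where
  "unit_cube = cbox 0 1"

definition linear_polys :: "(real ^ 'n::finite \<Rightarrow> real) set" where
  "linear_polys = {L. \<exists>c a. L = (\<lambda>x. c + (\<Sum>i\<in>UNIV. a $ i * x $ i))}"

definition linear_approx_error :: "(real ^ 'n::finite \<Rightarrow> real) \<Rightarrow> real" where
  "linear_approx_error f = (INF L\<in>linear_polys. SUP x\<in>unit_cube. \<bar>f x - L x\<bar>)"

definition second_difference :: "(real ^ 'n::finite \<Rightarrow> real) \<Rightarrow> real" where
  "second_difference f =
     (SUP (x, y)\<in>unit_cube \<times> unit_cube. \<bar>f x + f y - 2 * f ((1 / 2) *\<^sub>R (x + y))\<bar>)"

definition whitney_bound :: "'n::finite itself \<Rightarrow> real \<Rightarrow> bool" where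
  "whitney_bound _ w \<longleftrightarrow>
     (\<forall>f :: real ^ 'n \<Rightarrow> real. continuous_on unit_cube f \<longrightarrow>
        linear_approx_error f \<le> w * second_difference f)"

text \<open>The value is extended real so that it is \<open>\<infinity>\<close>, and not an unspecified real number, in case
  there is no admissible constant. By \<open>w2_eq_ereal_iff\<close> below, a real value is the
  smallest admissible constant.\<close>

definition w2 :: "'n::finite itself \<Rightarrow> ereal" where
  "w2 d = Inf (ereal ` {w. whitney_bound d w})"

lemma second_difference_nonneg:
  fixes f :: "real ^ 'n::finite \<Rightarrow> real"
  assumes "continuous_on unit_cube f"
  shows "second_difference f \<ge> 0"
proof -
  have "compact (f ` unit_cube)"
    using assms by (intro compact_continuous_image) (auto simp: unit_cube_def)
  then obtain B where B: "\<And>x. x \<in> unit_cube \<Longrightarrow> \<bar>f x\<bar> \<le> B"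
    by (metis bounded_real compact_imp_bounded imageI)
  have mid: "(1 / 2) *\<^sub>R (x + y) \<in> unit_cube" if "x \<in> unit_cube" "y \<in> unit_cube" for x y :: "real ^ 'n"
    using that convexD[of "unit_cube :: (real ^ 'n) set" x y "1/2" "1/2"]
    by (simp add: unit_cube_def scaleR_add_right)
  have bdd: "bdd_above ((\<lambda>(x, y). \<bar>f x + f y - 2 * f ((1 / 2) *\<^sub>R (x + y))\<bar>) ` (unit_cube \<times> unit_cube))"
  proof (rule bdd_aboveI2[where M = "4 * B"], clarify)
    fix x y :: "real ^ 'n"
    assume "x \<in> unit_cube" "y \<in> unit_cube"
    then show "\<bar>f x + f y - 2 * f ((1 / 2) *\<^sub>R (x + y))\<bar> \<le> 4 * B"
      using B[of x] B[of y] B[OF mid, of x y] by linarith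
  qed
  have "(0, 0) \<in> unit_cube \<times> (unit_cube :: (real ^ 'n) set)"
    by (simp add: unit_cube_def mem_box_cart)
  from cSUP_upper[OF this bdd] show ?thesis
    by (simp add: second_difference_def)
qed

lemma w2_eq_ereal_iff:
  "w2 d = ereal w \<longleftrightarrow> whitney_bound d w \<and> (\<forall>v. whitney_bound d v \<longrightarrow> w \<le> v)"
proof
  assume w: "w2 d = ereal w"
  have least: "w \<le> v" if "whitney_bound d v" for v
  proof -
    have "w2 d \<le> ereal v"
      unfolding w2_def using that by (intro Inf_lower) auto
    then show ?thesis using w by simp
  qed
  have "whitney_bound d w"
    unfolding whitney_bound_def
  proof (intro allI impI)
    fix f :: "real ^ 'a \<Rightarrow> real"
    assume f: "continuous_on unit_cube f"
    have *: "linear_approx_error f \<le> v * second_difference f" if "w < v" for v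
    proof -
      have "w2 d < ereal v" using w that by simp
      then obtain u where u: "whitney_bound d u" "u < v"
        unfolding w2_def Inf_less_iff by auto
      have "linear_approx_error f \<le> u * second_difference f"
        using u(1) f by (simp add: whitney_bound_def)
      also have "\<dots> \<le> v * second_difference f"
        using u(2) second_difference_nonneg[OF f] by (intro mult_right_mono) auto
      finally show ?thesis .
    qed
    have "((\<lambda>v. v * second_difference f) \<longlongrightarrow> w * second_difference f) (at_right w)"
      by (intro tendsto_intros)
    moreover have "\<forall>\<^sub>F v in at_right w. linear_approx_error f \<le> v * second_difference f"
      using * by (auto simp: eventually_at_right_field intro: exI[of _ "w + 1"])
    ultimately show "linear_approx_error f \<le> w * second_difference f"
      by (rule tendsto_lowerbound) simp
  qed
  with least show "whitney_bound d w \<and> (\<forall>v. whitney_bound d v \<longrightarrow> w \<le> v)" by blast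
next
  assume "whitney_bound d w \<and> (\<forall>v. whitney_bound d v \<longrightarrow> w \<le> v)"
  then show "w2 d = ereal w"
    unfolding w2_def by (intro Inf_eqI) auto
qed

end

theory Submission
  imports Defs "HOL-Combinatorics.Permutations"
begin

text \<open>After subtracting the part of \<open>f\<close> that is even about the centre of the cube, which is nearly
  constant, one has an odd function \<open>g\<close> on \<open>[-1,1]\<^sup>d\<close> with second differences at most \<open>D\<close>. By
  separation of convex sets, a linear functional close to \<open>g\<close> exists as soon as the mean of \<open>g\<close> over
  every finite family of points with sum \<open>0\<close> is bounded, independently of \<open>d\<close>.

  Put such a family on the vertices of a 16-regular graph in which every set of at most half of the
  vertices has at least as many boundary edges as elements. By max-flow min-cut, applied in each
  coordinate separately, there is a flow along the edges with values in \<open>[-1,1]\<^sup>d\<close> whose divergence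
  at every vertex is the given point. So each point is the sum of 16 points of the cube, and since
  \<open>g\<close> is odd, the values of \<open>g\<close> at the two ends of an edge cancel. Replacing \<open>g\<close> of a sum of 16
  points by the sum of the values of \<open>g\<close> costs \<open>32 D\<close> for the dyadic mean and \<open>15 D\<close> for the factor
  16. This is the concentrator argument of Kalton and Roberts with a flow in place of a matching.\<close>

section \<open>Expanding permutations\<close>

lemma ex_permutes_image_eq:
  assumes "finite X" "B \<subseteq> X" "B' \<subseteq> X" "card B = card B'"
  obtains \<sigma> where "\<sigma> permutes X" "\<sigma> ` B = B'"
proof -
  have fin: "finite B" "finite B'" "finite (X - B)" "finite (X - B')"
    using assms by (auto intro: finite_subset)
  obtain f where f: "bij_betw f B B'"
    using fin assms(4) finite_same_card_bij by blast
  have "card (X - B) = card (X - B')"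
    using assms fin by (simp add: card_Diff_subset)
  then obtain h where h: "bij_betw h (X - B) (X - B')"
    using fin finite_same_card_bij by blast
  define \<sigma> where "\<sigma> x = (if x \<in> B then f x else if x \<in> X then h x else x)" for x
  have 1: "bij_betw \<sigma> B B'"
    using f by (simp add: \<sigma>_def cong: bij_betw_cong)
  have 2: "bij_betw \<sigma> (X - B) (X - B')"
    using h by (rule bij_betw_cong[THEN iffD1, rotated]) (auto simp: \<sigma>_def)
  have "bij_betw \<sigma> (B \<union> (X - B)) (B' \<union> (X - B'))"
    by (rule bij_betw_combine[OF 1 2]) auto
  moreover have "B \<union> (X - B) = X" "B' \<union> (X - B') = X" using assms by auto
  ultimately have "\<sigma> permutes X"
    using assms(2) by (intro bij_imp_permutes) (auto simp: \<sigma>_def)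
  with 1 show ?thesis by (auto intro!: that simp: bij_betw_def)
qed

text \<open>Composition with a permutation carrying \<open>B\<close> to \<open>C\<close> injects the
  permutations with image \<open>B\<close> into those with image \<open>C\<close>. So each class,
  one for every \<open>C\<close> of the size of \<open>A\<close>, is at least as large as that of
  \<open>B\<close>, and the classes are disjoint.\<close>

lemma card_permutes_image_eq_le:
  assumes "finite X" "A \<subseteq> X" "B \<subseteq> X" "card B = card A"
  shows "card {p. p permutes X \<and> p ` A = B} * (card X choose card A) \<le> fact (card X)"
proof -
  define F where "F C = {p. p permutes X \<and> p ` A = C}" for C
  define \<B> where "\<B> = {C. C \<subseteq> X \<and> card C = card A}"
  have finF: "finite (F C)" for C
    using finite_permutations[OF assms(1)] by (rule rev_finite_subset) (auto simp: F_def)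
  have fin\<B>: "finite \<B>" using assms(1) by (auto simp: \<B>_def)
  have le: "card (F B) \<le> card (F C)" if "C \<in> \<B>" for C
  proof -
    have "C \<subseteq> X" "card B = card C" using that assms(4) by (auto simp: \<B>_def)
    from ex_permutes_image_eq[OF assms(1,3) this]
    obtain \<sigma> where \<sigma>: "\<sigma> permutes X" "\<sigma> ` B = C" .
    have "inj_on (\<lambda>p. \<sigma> \<circ> p) (F B)"
      using permutes_inj[OF \<sigma>(1)] by (auto intro!: inj_onI simp: fun_eq_iff inj_eq)
    moreover have "(\<lambda>p. \<sigma> \<circ> p) ` F B \<subseteq> F C"
      using \<sigma> by (auto simp: F_def image_comp[symmetric] permutes_compose)
    ultimately show ?thesis using finF by (rule card_inj_on_le)
  qed
  have "card (F B) * (card X choose card A) = (\<Sum>C\<in>\<B>. card (F B))"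
    using n_subsets[OF assms(1)] by (simp add: \<B>_def)
  also have "\<dots> \<le> (\<Sum>C\<in>\<B>. card (F C))" by (intro sum_mono le)
  also have "\<dots> = card (\<Union>C\<in>\<B>. F C)"
    using finF fin\<B> by (subst card_UN_disjoint) (auto simp: F_def)
  also have "\<dots> \<le> card {p. p permutes X}"
    by (intro card_mono finite_permutations assms) (auto simp: F_def)
  also have "\<dots> = fact (card X)" using assms(1) by (intro card_permutations) auto
  finally show ?thesis by (simp add: F_def)
qed

text \<open>\<open>B\<close> is determined by the pair \<open>A - B\<close>, \<open>B - A\<close>.
  Both have the same size \<open>T\<close>, because \<open>A\<close> and \<open>B\<close> are
  equally large.\<close>

lemma card_near_subsets_le:
  assumes "finite X" "A \<subseteq> X"
  shows "card {B. B \<subseteq> X \<and> card B = card A \<and> 2 * card (B - A) < s}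
    \<le> (\<Sum>T | 2 * T < s. (card A choose T) * (card (X - A) choose T))" (is "card ?N \<le> _")
proof -
  define G where "G T = {C. C \<subseteq> A \<and> card C = T} \<times> {C. C \<subseteq> X - A \<and> card C = T}" for T
  have finA: "finite A" using assms finite_subset by blast
  have finT: "finite {T. 2 * T < s}" by (rule finite_subset[of _ "{..<s}"]) auto
  have "inj_on (\<lambda>B. (A - B, B - A)) ?N" by (auto intro!: inj_onI)
  moreover have "(\<lambda>B. (A - B, B - A)) ` ?N \<subseteq> (\<Union>T\<in>{T. 2 * T < s}. G T)"
  proof (clarify)
    fix B assume B: "B \<subseteq> X" "card B = card A" "2 * card (B - A) < s"
    then have "card (A - B) = card (B - A)"
      using finA assms(1) by (metis card_le_sym_Diff finite_subset le_antisym order_refl)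
    then show "(A - B, B - A) \<in> (\<Union>T\<in>{T. 2 * T < s}. G T)"
      using B by (auto simp: G_def)
  qed
  moreover have "finite (\<Union>T\<in>{T. 2 * T < s}. G T)"
    using finT finA assms(1) by (auto simp: G_def)
  ultimately have "card ?N \<le> card (\<Union>T\<in>{T. 2 * T < s}. G T)" by (rule card_inj_on_le)
  also have "\<dots> \<le> (\<Sum>T | 2 * T < s. card (G T))" using finT by (rule card_UN_le)
  also have "\<dots> = (\<Sum>T | 2 * T < s. (card A choose T) * (card (X - A) choose T))"
    using finA assms(1) by (simp add: G_def card_cartesian_product n_subsets)
  finally show ?thesis .
qed

section \<open>Binomial estimates for the union bound\<close>

lemma binomial_power_le: "(n choose s) ^ k \<le> (k * n) choose (k * s)"
proof (induction k)
  case (Suc k)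
  have "(n choose s) ^ Suc k \<le> (n choose s) * ((k * n) choose (k * s))"
    using Suc by simp
  \<comment> \<open>Of the Vandermonde sum only the summand \<open>j = s\<close> is kept.\<close>
  also have "\<dots> \<le> (\<Sum>j\<le>s + k * s. (n choose j) * ((k * n) choose (s + k * s - j)))"
    using member_le_sum[of s "{..s + k * s}" "\<lambda>j. (n choose j) * ((k * n) choose (s + k * s - j))"]
    by simp
  also have "\<dots> = (n + k * n) choose (s + k * s)" by (rule vandermonde)
  finally show ?case by simp
qed simp

lemma sum_binomial_le_exp:
  assumes "x \<ge> (0::real)"
  shows "(\<Sum>T\<le>m. real (m choose T) * x ^ T) \<le> exp (real m * x)"
proof -
  have "(\<Sum>T\<le>m. real (m choose T) * x ^ T) = (x + 1) ^ m"
    by (simp add: binomial_ring)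
  also have "\<dots> \<le> exp x ^ m"
    using assms exp_ge_add_one_self[of x] by (intro power_mono) (auto simp: add.commute)
  finally show ?thesis by (simp add: exp_of_nat_mult)
qed

text \<open>A Chernoff-type bound: the factor x^T y^T q^(2T) equals 1 and can be inserted into each
  term, and \<open>2 * T < s\<close> lets q^(2T) grow to q^s. The remaining diagonal sum is part of
  a product of two binomial sums.\<close>

lemma sum_binomial_mult_le:
  fixes q x y :: real
  assumes "x \<ge> 0" "y \<ge> 0" "q \<ge> 1" "x * y * q\<^sup>2 = 1"
  shows "(\<Sum>T | 2 * T < s. real ((a choose T) * (b choose T)))
    \<le> q ^ s * exp (real a * x + real b * y)"
proof -
  let ?f = "\<lambda>T. real (a choose T) * x ^ T" and ?h = "\<lambda>T. real (b choose T) * y ^ T"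
  have fin: "finite {T. 2 * T < s}" by (rule finite_subset[of _ "{..<s}"]) auto
  have "(\<Sum>T | 2 * T < s. real ((a choose T) * (b choose T)))
      \<le> (\<Sum>T | 2 * T < s. q ^ s * (?f T * ?h T))"
  proof (rule sum_mono)
    fix T assume T: "T \<in> {T. 2 * T < s}"
    have "x ^ T * y ^ T * q ^ (2 * T) = (x * y * q\<^sup>2) ^ T"
      by (simp only: power_mult_distrib power_mult)
    then have "x ^ T * y ^ T * q ^ (2 * T) = 1"
      using assms(4) by simp
    then have "real ((a choose T) * (b choose T))
        = real ((a choose T) * (b choose T)) * (x ^ T * y ^ T * q ^ (2 * T))"
      by simp
    also have "\<dots> = q ^ (2 * T) * (?f T * ?h T)"
      by (simp only: of_nat_mult mult_ac)
    also have "\<dots> \<le> q ^ s * (?f T * ?h T)"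
      using T assms by (intro mult_right_mono power_increasing) auto
    finally show "real ((a choose T) * (b choose T)) \<le> q ^ s * (?f T * ?h T)" .
  qed
  also have "\<dots> = q ^ s * (\<Sum>T | 2 * T < s. ?f T * ?h T)" by (simp only: sum_distrib_left)
  also have "\<dots> \<le> q ^ s * ((\<Sum>T\<le>a. ?f T) * (\<Sum>T\<le>b. ?h T))"
  proof (rule mult_left_mono)
    have "(\<Sum>T | 2 * T < s. ?f T * ?h T) = (\<Sum>T\<in>{T. 2 * T < s} \<inter> {..a} \<inter> {..b}. ?f T * ?h T)"
      using fin by (intro sum.mono_neutral_right) (auto simp: not_le)
    also have "\<dots> = sum (\<lambda>(T, U). ?f T * ?h U) ((\<lambda>T. (T, T)) ` ({T. 2 * T < s} \<inter> {..a} \<inter> {..b}))"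
      by (subst sum.reindex) (auto intro: inj_onI)
    also have "\<dots> \<le> sum (\<lambda>(T, U). ?f T * ?h U) ({..a} \<times> {..b})"
      using assms by (intro sum_mono2) auto
    also have "\<dots> = (\<Sum>T\<le>a. ?f T) * (\<Sum>T\<le>b. ?h T)"
      by (simp only: sum_product sum.cartesian_product)
    finally show "(\<Sum>T | 2 * T < s. ?f T * ?h T) \<le> (\<Sum>T\<le>a. ?f T) * (\<Sum>T\<le>b. ?h T)" .
  qed (use assms in auto)
  also have "\<dots> \<le> q ^ s * (exp (real a * x) * exp (real b * y))"
    using assms by (intro mult_left_mono mult_mono sum_binomial_le_exp sum_nonneg) auto
  finally show ?thesis by (simp only: exp_add)
qed

text \<open>The generating function bound is applied at \<open>x = 1/16\<close> and \<open>y = x s / (n - s)\<close>, which makes both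
  exponential factors equal to \<open>exp (s / 2)\<close>; what remains is \<open>exp 2 \<le> 8\<close>.\<close>

lemma union_bound_term_le:
  assumes "0 < s" "2 * s \<le> n"
  shows "(\<Sum>T | 2 * T < s. real (((8 * s) choose T) * ((8 * (n - s)) choose T)))
    \<le> (1 / 2) ^ s * real (n choose s) ^ 7" (is "?N \<le> _")
proof -
  define r where "r = real (n - s) / real s"
  define t where "t = real n / real s"
  define q where "q = sqrt (256 * r)"
  have r: "r \<ge> 1" "r \<le> t" and t: "t \<ge> 2"
    using assms by (auto simp: r_def t_def field_simps)
  have q2: "q\<^sup>2 = 256 * r" using r by (simp add: q_def)
  have q: "q \<ge> 1" using r by (simp add: q_def)
  have "?N \<le> q ^ s * exp (real (8 * s) * (1 / 16) + real (8 * (n - s)) * (1 / (16 * r)))"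
    using r q q2 by (intro sum_binomial_mult_le) auto
  also have "real (8 * s) * (1 / 16) + real (8 * (n - s)) * (1 / (16 * r)) = real s * 1"
    using assms by (simp add: r_def field_simps)
  also have "q ^ s * exp (real s * 1) = (q * exp 1) ^ s"
    by (simp only: power_mult_distrib exp_of_nat_mult)
  also have "\<dots> \<le> (1 / 2 * t ^ 7) ^ s"
  proof (rule power_mono)
    have "exp (1::real) ^ 2 \<le> (272 / 100) ^ 2"
      using e_less_272 by (intro power_mono) auto
    then have e: "exp (1::real) ^ 2 \<le> 8" by (simp add: power2_eq_square)
    have "(q * exp 1) ^ 2 = 256 * r * exp 1 ^ 2"
      using q2 by (simp only: power_mult_distrib)
    also have "\<dots> \<le> 256 * t * 8" using e r by (intro mult_mono) auto
    \<comment> \<open>256 * 8 = 2^11 is written as 2^13 / 4: by \<open>t \<ge> 2\<close> the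
      thirteen factors 2 become factors \<open>t\<close>, which completes the square of t^7 /
      2.\<close>
    also have "\<dots> = 1 / 4 * 2 ^ 13 * t" by simp
    also have "\<dots> \<le> 1 / 4 * t ^ 13 * t"
      using t by (intro mult_right_mono mult_left_mono power_mono) auto
    also have "\<dots> = 1 / 4 * t ^ (7 * 2)" using power_add[of t 13 1] by simp
    also have "\<dots> = (1 / 2 * t ^ 7) ^ 2"
      by (subst power_mult) (simp add: power2_eq_square)
    finally show "q * exp 1 \<le> 1 / 2 * t ^ 7"
      by (rule power2_le_imp_le) (use t in simp)
  qed (use q in auto)
  also have "\<dots> = (1 / 2) ^ s * (t ^ s) ^ 7"
    by (simp only: power_mult_distrib power_mult[symmetric] mult.commute[of 7 s])
  also have "\<dots> \<le> (1 / 2) ^ s * real (n choose s) ^ 7"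
    unfolding t_def using assms binomial_ge_n_over_k_pow_k[of s n, where 'a=real]
    by (intro mult_left_mono power_mono) auto
  finally show ?thesis .
qed

text \<open>The permutation \<open>p\<close> encodes the 16-regular graph with an edge from \<open>v\<close> to \<open>fst (p (v, l))\<close> for every
  \<open>v\<close> and every \<open>l < 8\<close>; half of the boundary edges of \<open>S\<close> leave \<open>S\<close> and half of them enter it.\<close>

lemma ex_expanding_permutation:
  fixes V :: "'a set"
  assumes "finite V"
  obtains p where "p permutes V \<times> {..<8::nat}"
    "\<And>S. S \<subseteq> V \<Longrightarrow> 2 * card S \<le> card V \<Longrightarrow>
       card S \<le> 2 * card (p ` (S \<times> {..<8}) - S \<times> {..<8})"
proof -
  define n where "n = card V"
  define X where "X = V \<times> {..<8::nat}"
  define P where "P = {p. p permutes X}"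
  define bad where "bad S = {p \<in> P. 2 * card (p ` (S \<times> {..<8}) - S \<times> {..<8}) < card S}" for S
  define small where "small s = {S. S \<subseteq> V \<and> card S = s}" for s
  have finX: "finite X" and cardX: "card X = 8 * n"
    using assms by (auto simp: X_def n_def card_cartesian_product)
  have finP: "finite P" and cardP: "card P = fact (8 * n)"
    using finX cardX by (auto simp: P_def finite_permutations card_permutations)
  have bad_le: "real (card (bad S)) * real (n choose s) \<le> (1 / 2) ^ s * fact (8 * n)"
    if S: "S \<in> small s" and s: "0 < s" "2 * s \<le> n" for S s
  proof -
    define A where "A = S \<times> {..<8::nat}"
    \<comment> \<open>The possible images of \<open>A\<close> under a permutation that is bad for
      \<open>S\<close>.\<close>
    define N where "N = {B. B \<subseteq> X \<and> card B = card A \<and> 2 * card (B - A) < s}"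
    have SV: "S \<subseteq> V" "card S = s" using S by (auto simp: small_def)
    have finS: "finite S" using SV assms finite_subset by blast
    have A: "A \<subseteq> X" "card A = 8 * s"
      using SV by (auto simp: A_def X_def card_cartesian_product)
    have "card (X - A) = 8 * (n - s)"
      using A finX finite_subset[OF A(1) finX] cardX by (simp add: card_Diff_subset)
    then have "card N \<le> (\<Sum>T | 2 * T < s. ((8 * s) choose T) * ((8 * (n - s)) choose T))"
      using card_near_subsets_le[OF finX A(1), of s] A(2) by (simp add: N_def)
    then have "real (card N) \<le> (\<Sum>T | 2 * T < s. real (((8 * s) choose T) * ((8 * (n - s)) choose T)))"
      by (simp only: of_nat_le_iff flip: of_nat_sum)
    also have "\<dots> \<le> (1 / 2) ^ s * real (n choose s) ^ 7"
      by (rule union_bound_term_le[OF s])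
    finally have N: "real (card N) \<le> (1 / 2) ^ s * real (n choose s) ^ 7" .
    have "bad S \<subseteq> (\<Union>B\<in>N. {p. p permutes X \<and> p ` A = B})"
    proof
      fix p assume p: "p \<in> bad S"
      then have "p permutes X" by (simp add: bad_def P_def)
      then have "p ` A \<subseteq> X" "card (p ` A) = card A"
        using A(1) permutes_image[of p X] permutes_inj_on[of p X A] by (auto intro: card_image)
      then show "p \<in> (\<Union>B\<in>N. {p. p permutes X \<and> p ` A = B})"
        using p SV by (auto simp: bad_def P_def N_def A_def)
    qed
    moreover have "finite N" using finX by (auto simp: N_def)
    ultimately have "card (bad S) \<le> (\<Sum>B\<in>N. card {p. p permutes X \<and> p ` A = B})"
      using finite_permutations[OF finX]
      by (intro order.trans[OF card_mono card_UN_le]) (auto intro: rev_finite_subset)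
    then have "card (bad S) * (card X choose card A)
        \<le> (\<Sum>B\<in>N. card {p. p permutes X \<and> p ` A = B} * (card X choose card A))"
      by (simp only: sum_distrib_right[symmetric] mult_le_mono1)
    also have "\<dots> \<le> (\<Sum>B\<in>N. fact (card X))"
      using finX A(1) by (intro sum_mono card_permutes_image_eq_le) (auto simp: N_def)
    finally have "card (bad S) * ((8 * n) choose (8 * s)) \<le> card N * fact (8 * n)"
      using A(2) cardX by simp
    moreover have "card (bad S) * (n choose s) ^ 8 \<le> card (bad S) * ((8 * n) choose (8 * s))"
      by (intro mult_le_mono2 binomial_power_le)
    ultimately have "card (bad S) * (n choose s) ^ 8 \<le> card N * fact (8 * n)"
      by (rule order.trans[rotated])
    then have "real (card (bad S) * (n choose s) ^ 8) \<le> real (card N * fact (8 * n))"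
      by (simp only: of_nat_le_iff)
    then have "real (card (bad S)) * real (n choose s) ^ 8 \<le> real (card N) * fact (8 * n)"
      by (simp only: of_nat_fact of_nat_mult of_nat_power)
    also have "\<dots> \<le> (1 / 2) ^ s * real (n choose s) ^ 7 * fact (8 * n)"
      using N by (intro mult_right_mono) auto
    \<comment> \<open>Of the eight factors \<open>n choose s\<close>, one for each edge leaving a
      vertex, seven cancel against the bound for \<open>N\<close>. The eighth pays for the number of
      sets \<open>S\<close> of size \<open>s\<close>.\<close>
    finally have "real (n choose s) ^ 7 * (real (card (bad S)) * real (n choose s))
        \<le> real (n choose s) ^ 7 * ((1 / 2) ^ s * fact (8 * n))"
      by (simp add: eval_nat_numeral mult_ac)
    moreover have "real (n choose s) ^ 7 > 0" using s by simp
    ultimately show ?thesis by (simp only: mult_le_cancel_left_pos)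
  qed
  \<comment> \<open>Union bound: all sets of size \<open>s\<close> together spoil at most the
    fraction 2^(-s) of the permutations. The finite sum of these fractions over
    \<open>s \<ge> 1\<close> is strictly below 1, so some permutation is bad for no set.\<close>
  define m where "m = n div 2"
  have fin_small: "finite (small s)" for s
    using assms by (auto simp: small_def)
  have "real (card (\<Union>s\<in>{1..m}. \<Union>S\<in>small s. bad S)) \<le> (\<Sum>s\<in>{1..m}. \<Sum>S\<in>small s. real (card (bad S)))"
  proof -
    have "card (\<Union>s\<in>{1..m}. \<Union>S\<in>small s. bad S) \<le> (\<Sum>s\<in>{1..m}. card (\<Union>S\<in>small s. bad S))"
      by (rule card_UN_le) simp
    also have "\<dots> \<le> (\<Sum>s\<in>{1..m}. \<Sum>S\<in>small s. card (bad S))"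
      by (intro sum_mono card_UN_le fin_small)
    finally show ?thesis by (simp flip: of_nat_sum)
  qed
  also have "\<dots> \<le> (\<Sum>s\<in>{1..m}. (1 / 2) ^ s * fact (8 * n))"
  proof (rule sum_mono)
    fix s assume s: "s \<in> {1..m}"
    have pos: "real (n choose s) > 0" using s by (auto simp: m_def)
    have "(\<Sum>S\<in>small s. real (card (bad S))) \<le> (\<Sum>S\<in>small s. (1 / 2) ^ s * fact (8 * n) / real (n choose s))"
      using bad_le s pos by (intro sum_mono) (auto simp: field_simps m_def)
    also have "\<dots> = (1 / 2) ^ s * fact (8 * n)"
      using pos n_subsets[OF assms, of s] by (simp add: small_def n_def)
    finally show "(\<Sum>S\<in>small s. real (card (bad S))) \<le> (1 / 2) ^ s * fact (8 * n)" .
  qed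
  also have "\<dots> = (\<Sum>s\<in>{1..m}. (1 / 2) ^ s) * fact (8 * n)" by (simp only: sum_distrib_right)
  also have "\<dots> < 1 * fact (8 * n)"
  proof (rule mult_strict_right_mono)
    have "(\<Sum>s\<in>{1..m}. (1 / 2) ^ s) = 1 - (1 / 2 :: real) ^ m"
      by (induction m) (auto simp: field_simps)
    then show "(\<Sum>s\<in>{1..m}. (1 / 2) ^ s) < (1 :: real)" by simp
  qed simp
  finally have "real (card (\<Union>s\<in>{1..m}. \<Union>S\<in>small s. bad S)) < real (card P)"
    by (simp only: cardP of_nat_fact mult_1_left)
  then have less: "card (\<Union>s\<in>{1..m}. \<Union>S\<in>small s. bad S) < card P"
    by (simp only: of_nat_less_iff)
  have "finite (\<Union>s\<in>{1..m}. \<Union>S\<in>small s. bad S)"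
    using fin_small finP by (auto simp: bad_def)
  from card_mono[OF this, of P] less
  have "\<not> P \<subseteq> (\<Union>s\<in>{1..m}. \<Union>S\<in>small s. bad S)" by (auto simp only: not_less[symmetric])
  then obtain p where p: "p \<in> P" "p \<notin> (\<Union>s\<in>{1..m}. \<Union>S\<in>small s. bad S)" by blast
  show thesis
  proof (rule that)
    show "p permutes V \<times> {..<8}" using p(1) by (simp add: P_def X_def)
    fix S assume S: "S \<subseteq> V" "2 * card S \<le> card V"
    show "card S \<le> 2 * card (p ` (S \<times> {..<8}) - S \<times> {..<8})"
    proof (cases "card S = 0")
      case False
      then have "card S \<in> {1..m}" "S \<in> small (card S)"
        using S by (auto simp: m_def n_def small_def)
      then have "p \<notin> bad S" using p(2) by blast
      then show ?thesis using p(1) by (simp add: bad_def)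
    qed simp
  qed
qed

section \<open>Flows\<close>

text \<open>The flow minimises the sum of the squares of the residuals \<open>r\<close>. An edge between vertices with
  different residuals is then saturated, so the set where \<open>r\<close> is maximal would violate the cut
  condition if its maximum were positive.\<close>

lemma ex_flow:
  fixes a :: "'v \<Rightarrow> real" and s t :: "'e \<Rightarrow> 'v"
  assumes fin: "finite V" "finite E"
    and st: "\<And>e. e \<in> E \<Longrightarrow> s e \<in> V" "\<And>e. e \<in> E \<Longrightarrow> t e \<in> V"
    and sum0: "(\<Sum>v\<in>V. a v) = 0"
    and cut: "\<And>S. S \<subseteq> V \<Longrightarrow> (\<Sum>v\<in>S. a v) \<le> real (card {e \<in> E. (s e \<in> S) \<noteq> (t e \<in> S)})"
  obtains z where "\<And>e. e \<in> E \<Longrightarrow> \<bar>z e\<bar> \<le> 1"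
    "\<And>v. v \<in> V \<Longrightarrow> (\<Sum>e | e \<in> E \<and> s e = v. z e) - (\<Sum>e | e \<in> E \<and> t e = v. z e) = a v"
proof -
  \<comment> \<open>Coordinates outside \<open>E\<close> are pinned to 0, so that \<open>K\<close>
    is a product of compact sets over the whole type and hence compact.\<close>
  define K where "K = PiE UNIV (\<lambda>e. if e \<in> E then {-1..1::real} else {0})"
  define r where "r z v = a v - ((\<Sum>e | e \<in> E \<and> s e = v. z e) - (\<Sum>e | e \<in> E \<and> t e = v. z e))"
    for z :: "'e \<Rightarrow> real" and v
  have "compact K" 
    unfolding K_def using compactin_PiE[of "\<lambda>_::'e. euclidean :: real topology" UNIV]
    by (simp add: euclidean_product_topology)
  moreover have "(\<lambda>_. 0) \<in> K" by (auto simp: K_def)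
  moreover have "continuous_on K (\<lambda>z. \<Sum>v\<in>V. (r z v)\<^sup>2)"
    unfolding r_def by (intro continuous_intros continuous_on_product_coordinates[THEN continuous_on_subset]) auto
  ultimately obtain z where z: "z \<in> K" and min: "\<And>y. y \<in> K \<Longrightarrow> (\<Sum>v\<in>V. (r z v)\<^sup>2) \<le> (\<Sum>v\<in>V. (r y v)\<^sup>2)"
    using continuous_attains_inf[of K "\<lambda>z. \<Sum>v\<in>V. (r z v)\<^sup>2"] by blast
  have K_iff: "y \<in> K \<longleftrightarrow> (\<forall>e. if e \<in> E then \<bar>y e\<bar> \<le> 1 else y e = 0)" for y
    unfolding K_def PiE_iff by (auto simp: abs_le_iff minus_le_iff split: if_splits)
  have zE: "\<bar>z e\<bar> \<le> 1" if "e \<in> E" for e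
    using z that unfolding K_iff by presburger
  have r_upd: "r (z(e := z e + \<delta>)) v = r z v - (if s e = v then \<delta> else 0) + (if t e = v then \<delta> else 0)"
    if e: "e \<in> E" for e \<delta> v
  proof -
    have *: "(\<Sum>e' | e' \<in> E \<and> f e' = v. (z(e := z e + \<delta>)) e')
        = (\<Sum>e' | e' \<in> E \<and> f e' = v. z e') + (if f e = v then \<delta> else 0)" for f :: "'e \<Rightarrow> 'v"
    proof -
      have "(\<Sum>e' | e' \<in> E \<and> f e' = v. (z(e := z e + \<delta>)) e')
          = (\<Sum>e' | e' \<in> E \<and> f e' = v. z e' + (if e' = e then \<delta> else 0))"
        by (rule sum.cong) auto
      also have "\<dots> = (\<Sum>e' | e' \<in> E \<and> f e' = v. z e') + (if f e = v then \<delta> else 0)"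
        using fin(2) e by (simp add: sum.distrib sum.delta)
      finally show ?thesis .
    qed
    show ?thesis by (simp only: r_def *)
  qed
  \<comment> \<open>Raising \<open>z e\<close> by \<open>\<delta>\<close> changes the sum of squares
    by twice \<open>\<delta>\<^sup>2 - \<delta> * (r z (s e) - r z (t e))\<close>, which must not be
    negative at a minimum.\<close>
  have no_descent: False
    if e: "e \<in> E" and zd: "\<bar>z e + \<delta>\<bar> \<le> 1" and \<delta>: "\<delta> * (r z (s e) - r z (t e)) > \<delta>\<^sup>2" for e \<delta>
  proof -
    let ?y = "z(e := z e + \<delta>)"
    have ne: "s e \<noteq> t e" using \<delta> by auto
    have "?y \<in> K" using z zd e by (simp add: K_iff)
    then have "(\<Sum>v\<in>V. (r z v)\<^sup>2) \<le> (\<Sum>v\<in>V. (r ?y v)\<^sup>2)" by (rule min)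
    moreover have "(\<Sum>v\<in>V. f v) = f (s e) + f (t e) + (\<Sum>v\<in>V - {s e, t e}. f v)" for f :: "'v \<Rightarrow> real"
      using sum.subset_diff[of "{s e, t e}" V f] st[OF e] fin ne by simp
    moreover have "(\<Sum>v\<in>V - {s e, t e}. (r ?y v)\<^sup>2) = (\<Sum>v\<in>V - {s e, t e}. (r z v)\<^sup>2)"
      by (rule sum.cong) (auto simp: r_upd[OF e])
    ultimately have "(r z (s e))\<^sup>2 + (r z (t e))\<^sup>2 \<le> (r z (s e) - \<delta>)\<^sup>2 + (r z (t e) + \<delta>)\<^sup>2"
      using ne by (simp add: r_upd[OF e])
    then show False using \<delta> by (simp add: power2_eq_square algebra_simps)
  qed
  have tight: "z e = 1" if e: "e \<in> E" and gt: "r z (s e) > r z (t e)" for e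
  proof (rule ccontr)
    assume "z e \<noteq> 1"
    then have lt: "z e < 1" using zE[OF e] by auto
    \<comment> \<open>The first bound keeps the flow admissible; the half makes
      \<open>\<delta>\<close> strictly smaller than the difference of the residuals.\<close>
    define \<delta> where "\<delta> = min (1 - z e) ((r z (s e) - r z (t e)) / 2)"
    have "\<delta> > 0" "\<delta> \<le> 1 - z e" "\<delta> < r z (s e) - r z (t e)"
      using lt gt by (auto simp: \<delta>_def min_less_iff_disj)
    then show False
      using no_descent[OF e, of \<delta>] zE[OF e] by (simp add: power2_eq_square abs_le_iff)
  qed
  have tight': "z e = -1" if e: "e \<in> E" and gt: "r z (s e) < r z (t e)" for e
  proof (rule ccontr)
    assume "z e \<noteq> -1"
    then have lt: "z e > -1" using zE[OF e] by auto
    define \<delta> where "\<delta> = min (1 + z e) ((r z (t e) - r z (s e)) / 2)"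
    have d: "\<delta> > 0" "\<delta> \<le> 1 + z e" "\<delta> < r z (t e) - r z (s e)"
      using lt gt by (auto simp: \<delta>_def min_less_iff_disj)
    then have "\<delta> * \<delta> < \<delta> * (r z (t e) - r z (s e))" by simp
    then show False
      using d no_descent[OF e, of "- \<delta>"] zE[OF e] by (simp add: power2_eq_square abs_le_iff algebra_simps)
  qed
  have sum_r: "(\<Sum>v\<in>S. r z v) = (\<Sum>v\<in>S. a v) - (\<Sum>e\<in>E. (of_bool (s e \<in> S) - of_bool (t e \<in> S)) * z e)"
    if "S \<subseteq> V" for S
  proof -
    have *: "(\<Sum>v\<in>S. \<Sum>e | e \<in> E \<and> f e = v. z e) = (\<Sum>e\<in>E. of_bool (f e \<in> S) * z e)" for f :: "'e \<Rightarrow> 'v"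
    proof -
      have "finite S" using that fin finite_subset by blast
      then have "(\<Sum>v\<in>S. \<Sum>e | e \<in> E \<and> f e = v. z e) = (\<Sum>v\<in>S. \<Sum>e | e \<in> {e \<in> E. f e \<in> S} \<and> f e = v. z e)"
        by (intro sum.cong) auto
      also have "\<dots> = (\<Sum>e | e \<in> E \<and> f e \<in> S. z e)"
        using fin \<open>finite S\<close> by (intro sum.group) auto
      also have "\<dots> = (\<Sum>e\<in>E. of_bool (f e \<in> S) * z e)"
        using fin(2) by (intro sum.mono_neutral_cong_left) auto
      finally show ?thesis .
    qed
    show ?thesis
      by (simp add: r_def sum_subtractf * left_diff_distrib)
  qed
  have r0: "(\<Sum>v\<in>V. r z v) = 0"
    using sum_r[of V] sum0 st by simp
  have nonpos: "r z v \<le> 0" if v: "v \<in> V" for v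
  proof -
    define \<mu> where "\<mu> = Max (r z ` V)"
    define S where "S = {w \<in> V. r z w = \<mu>}"
    have le: "r z w \<le> \<mu>" if "w \<in> V" for w using fin that by (simp add: \<mu>_def)
    have "\<mu> \<in> r z ` V" unfolding \<mu>_def using fin v by (intro Max_in) auto
    then have S: "S \<subseteq> V" "S \<noteq> {}" "finite S" using fin by (auto simp: S_def)
    \<comment> \<open>An edge leaving \<open>S\<close> goes to a smaller residual and carries 1, an
      edge entering \<open>S\<close> carries -1; either way the net outflow is 1.\<close>
    have "(of_bool (s e \<in> S) - of_bool (t e \<in> S)) * z e = of_bool ((s e \<in> S) \<noteq> (t e \<in> S))"
      if e: "e \<in> E" for e
      using tight[OF e] tight'[OF e] st[OF e] le[of "s e"] le[of "t e"] by (auto simp: S_def)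
    then have "(\<Sum>e\<in>E. (of_bool (s e \<in> S) - of_bool (t e \<in> S)) * z e)
        = (\<Sum>e\<in>E. of_bool ((s e \<in> S) \<noteq> (t e \<in> S)))"
      by simp
    also have "\<dots> = real (card {e \<in> E. (s e \<in> S) \<noteq> (t e \<in> S)})"
      using fin(2) by (simp add: Int_def flip: of_bool_eq_iff)
    finally have "(\<Sum>v\<in>S. r z v) \<le> 0" using sum_r[OF S(1)] cut[OF S(1)] by simp
    moreover have "(\<Sum>v\<in>S. r z v) = real (card S) * \<mu>" by (simp add: S_def)
    ultimately have "\<mu> \<le> 0" using S by (simp add: mult_le_0_iff card_gt_0_iff not_le[symmetric])
    then show ?thesis using le[OF v] by simp
  qed
  have "r z v = 0" if "v \<in> V" for v
    using sum_nonneg_eq_0_iff[of V "\<lambda>v. - r z v"] nonpos r0 fin that by (simp add: sum_negf)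
  then show thesis using zE by (intro that) (auto simp: r_def)
qed

section \<open>Odd functions with small second differences\<close>

lemma sum_lessThan_add:
  fixes f :: "nat \<Rightarrow> 'a::comm_monoid_add"
  shows "(\<Sum>j<m + k. f j) = (\<Sum>j<m. f j) + (\<Sum>j<k. f (m + j))"
  by (induction k) (simp_all add: add.assoc)

lemma symmetric_box_mem_iff:
  fixes x :: "real ^ 'n"
  shows "x \<in> cbox (-1) 1 \<longleftrightarrow> (\<forall>k. \<bar>x $ k\<bar> \<le> 1)"
  by (auto simp: mem_box_cart abs_le_iff minus_le_iff)

locale odd_almost_affine =
  fixes g :: "real ^ 'n::finite \<Rightarrow> real" and D :: real
  assumes odd: "x \<in> cbox (-1) 1 \<Longrightarrow> g (- x) = - g x"
    and second_diff: "x \<in> cbox (-1) 1 \<Longrightarrow> y \<in> cbox (-1) 1 \<Longrightarrow>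
      \<bar>g x + g y - 2 * g ((1 / 2) *\<^sub>R (x + y))\<bar> \<le> D"
begin

abbreviation Q :: "(real ^ 'n) set" where "Q \<equiv> cbox (-1) 1"

section \<open>Approximate additivity and homogeneity\<close>

lemma zero_mem: "0 \<in> Q"
  by (simp add: symmetric_box_mem_iff)

lemma g_zero: "g 0 = 0"
  using odd[OF zero_mem] by simp

lemma D_nonneg: "D \<ge> 0"
  using second_diff[OF zero_mem zero_mem] by simp

lemma scaleR_mem: "x \<in> Q \<Longrightarrow> \<bar>c\<bar> \<le> 1 \<Longrightarrow> c *\<^sub>R x \<in> Q"
  by (auto simp: symmetric_box_mem_iff abs_mult intro: mult_le_one)

text \<open>Averaging in pairs along a binary tree of depth \<open>p\<close>: each of the
  \<open>p\<close> levels costs 2^(p-1) times \<open>D\<close>.\<close>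

lemma dyadic_mean:
  fixes w :: "nat \<Rightarrow> real ^ 'n"
  assumes "\<And>j. j < 2 ^ p \<Longrightarrow> w j \<in> Q"
  shows "(1 / 2 ^ p) *\<^sub>R (\<Sum>j<2 ^ p. w j) \<in> Q \<and>
    \<bar>(\<Sum>j<2 ^ p. g (w j)) - 2 ^ p * g ((1 / 2 ^ p) *\<^sub>R (\<Sum>j<2 ^ p. w j))\<bar> \<le> real p * 2 ^ p / 2 * D"
  using assms
proof (induction p arbitrary: w)
  case 0
  then show ?case by simp
next
  case (Suc p)
  define a where "a = (1 / 2 ^ p) *\<^sub>R (\<Sum>j<2 ^ p. w j)"
  define b where "b = (1 / 2 ^ p) *\<^sub>R (\<Sum>j<2 ^ p. w (2 ^ p + j))"
  have a: "a \<in> Q" "\<bar>(\<Sum>j<2 ^ p. g (w j)) - 2 ^ p * g a\<bar> \<le> real p * 2 ^ p / 2 * D"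
    using Suc.IH[of w] Suc.prems by (auto simp: a_def)
  have b: "b \<in> Q" "\<bar>(\<Sum>j<2 ^ p. g (w (2 ^ p + j))) - 2 ^ p * g b\<bar> \<le> real p * 2 ^ p / 2 * D"
    using Suc.IH[of "\<lambda>j. w (2 ^ p + j)"] Suc.prems by (auto simp: b_def)
  have two: "(2::nat) ^ Suc p = 2 ^ p + 2 ^ p" by simp
  have mean: "(1 / 2 ^ Suc p) *\<^sub>R (\<Sum>j<2 ^ Suc p. w j) = (1 / 2) *\<^sub>R (a + b)"
    unfolding two sum_lessThan_add by (simp add: a_def b_def scaleR_add_right)
  have "(1 / 2) *\<^sub>R (a + b) \<in> Q"
    using a(1) b(1) convexD[OF convex_box(1), of a "-1" 1 b "1/2" "1/2"]
    by (simp add: scaleR_add_right)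
  moreover have "2 ^ p * \<bar>g a + g b - 2 * g ((1 / 2) *\<^sub>R (a + b))\<bar> \<le> 2 ^ p * D"
    using second_diff[OF a(1) b(1)] by simp
  then have "\<bar>2 ^ p * g a + 2 ^ p * g b - 2 ^ Suc p * g ((1 / 2) *\<^sub>R (a + b))\<bar> \<le> 2 ^ p * D"
    by (simp add: abs_mult_pos' algebra_simps)
  moreover have "(\<Sum>j<2 ^ Suc p. g (w j)) = (\<Sum>j<2 ^ p. g (w j)) + (\<Sum>j<2 ^ p. g (w (2 ^ p + j)))"
    unfolding two sum_lessThan_add ..
  moreover have "real (Suc p) * 2 ^ Suc p / 2 * D = real p * 2 ^ p / 2 * D + real p * 2 ^ p / 2 * D + 2 ^ p * D"
    by (simp add: algebra_simps)
  ultimately show ?case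
    unfolding mean using a(2) b(2) by linarith
qed

text \<open>Repeated halving, by the second difference at the current point and 0. The costs
  \<open>D\<close>, \<open>2 * D\<close>, \<open>4 * D\<close> and so on form a geometric
  sum.\<close>

lemma dyadic_homogeneous:
  assumes "x \<in> Q"
  shows "\<bar>2 ^ p * g ((1 / 2 ^ p) *\<^sub>R x) - g x\<bar> \<le> (2 ^ p - 1) * D"
proof (induction p)
  case (Suc p)
  define y where "y = (1 / 2 ^ p) *\<^sub>R x"
  have "y \<in> Q" unfolding y_def by (rule scaleR_mem[OF assms]) simp
  from second_diff[OF this zero_mem]
  have "2 ^ p * \<bar>g y - 2 * g ((1 / 2) *\<^sub>R y)\<bar> \<le> 2 ^ p * D" by (simp add: g_zero)
  moreover have "(1 / 2) *\<^sub>R y = (1 / 2 ^ Suc p) *\<^sub>R x" by (simp add: y_def)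
  ultimately have "\<bar>2 ^ p * g y - 2 ^ Suc p * g ((1 / 2 ^ Suc p) *\<^sub>R x)\<bar> \<le> 2 ^ p * D"
    by (simp add: abs_mult_pos' algebra_simps)
  moreover have "(2 ^ Suc p - 1) * D = (2 ^ p - 1) * D + 2 ^ p * D" by (simp add: algebra_simps)
  ultimately show ?case using Suc.IH unfolding y_def[symmetric] by linarith
qed simp

lemma abs_sum_16_diff_le:
  fixes w :: "nat \<Rightarrow> real ^ 'n"
  assumes "\<And>j. j < 16 \<Longrightarrow> w j \<in> Q" "(\<Sum>j<16. w j) \<in> Q"
  shows "\<bar>(\<Sum>j<16. g (w j)) - g (\<Sum>j<16. w j)\<bar> \<le> 47 * D"
proof -
  let ?m = "g ((1 / 16) *\<^sub>R (\<Sum>j<16. w j))"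
  have "\<bar>(\<Sum>j<16. g (w j)) - 16 * ?m\<bar> \<le> 32 * D"
    using dyadic_mean[of 4 w] assms(1) by simp
  moreover have "\<bar>16 * ?m - g (\<Sum>j<16. w j)\<bar> \<le> 15 * D"
    using dyadic_homogeneous[OF assms(2), of 4] by simp
  ultimately show ?thesis by linarith
qed

section \<open>Families with sum zero, decomposed along a flow\<close>

lemma sum_le_of_sum_zero:
  fixes x :: "'i \<Rightarrow> real ^ 'n"
  assumes I: "finite I" and xQ: "\<And>i. i \<in> I \<Longrightarrow> x i \<in> Q" and sum0: "(\<Sum>i\<in>I. x i) = 0"
  shows "(\<Sum>i\<in>I. g (x i)) \<le> 47 * D * real (card I)"
proof -
  obtain p where p: "p permutes I \<times> {..<8::nat}"
    and expand: "\<And>S. S \<subseteq> I \<Longrightarrow> 2 * card S \<le> card I \<Longrightarrow>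
       card S \<le> 2 * card (p ` (S \<times> {..<8}) - S \<times> {..<8})"
    using ex_expanding_permutation[OF I] by blast
  define E where "E = I \<times> {..<8::nat}"
  define q where "q = inv p"
  note pE = p[folded E_def]
  have q: "q permutes E" unfolding q_def by (rule permutes_inv[OF pE])
  have finE: "finite E" using I by (simp add: E_def)
  have pIn: "p e \<in> E" if "e \<in> E" for e using permutes_in_image[OF pE] that by blast
  \<comment> \<open>The boundary edges of \<open>S\<close> in the graph given by
    \<open>p\<close>.\<close>
  define C where "C S = {e \<in> E. (fst e \<in> S) \<noteq> (fst (p e) \<in> S)}" for S
  have C_compl: "C (I - S) = C S" if "S \<subseteq> I" for S
    using pIn by (fastforce simp: C_def E_def mem_Times_iff)
  \<comment> \<open>The map \<open>p\<close> sends the edges leaving \<open>S\<close> onto the part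
    of the image of \<open>A\<close> outside \<open>A\<close>, and those entering \<open>S\<close>
    onto the part of \<open>A\<close> outside the image. These parts are equally large because
    \<open>p\<close> preserves the size of \<open>A\<close>.\<close>
  have card_C: "card (C S) = 2 * card (p ` (S \<times> {..<8}) - S \<times> {..<8})" if "S \<subseteq> I" for S
  proof -
    define A where "A = S \<times> {..<8::nat}"
    have A: "A \<subseteq> E" using that by (auto simp: A_def E_def)
    have finA: "finite A" using finite_subset[OF A finE] .
    have in_A: "e \<in> A \<longleftrightarrow> fst e \<in> S" if "e \<in> E" for e using that by (auto simp: A_def E_def)
    have C_eq: "C S = {e \<in> A. p e \<notin> A} \<union> {e \<in> E - A. p e \<in> A}"
      using A by (auto simp: C_def in_A pIn)
    have inj: "inj_on p B" for B by (rule permutes_inj_on[OF pE])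
    have "p ` {e \<in> A. p e \<notin> A} = p ` A - A" by auto
    then have 1: "card {e \<in> A. p e \<notin> A} = card (p ` A - A)"
      using card_image[OF inj] by metis
    have "p ` {e \<in> E - A. p e \<in> A} = A - p ` A"
    proof
      show "p ` {e \<in> E - A. p e \<in> A} \<subseteq> A - p ` A"
        using permutes_inj[OF pE] by (auto simp: inj_eq)
      show "A - p ` A \<subseteq> p ` {e \<in> E - A. p e \<in> A}"
      proof
        fix y assume y: "y \<in> A - p ` A"
        then have "y \<in> p ` E" using A permutes_image[OF pE] by auto
        then obtain e where "e \<in> E" "y = p e" by blast
        with y show "y \<in> p ` {e \<in> E - A. p e \<in> A}" by auto
      qed
    qed
    then have 2: "card {e \<in> E - A. p e \<in> A} = card (A - p ` A)"
      using card_image[OF inj] by metis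
    have 3: "card (A - p ` A) = card (p ` A - A)"
      using card_le_sym_Diff[of A "p ` A"] card_le_sym_Diff[of "p ` A" A] finA card_image[OF inj, of A]
      by simp
    have "card (C S) = card {e \<in> A. p e \<notin> A} + card {e \<in> E - A. p e \<in> A}"
      unfolding C_eq using finA finE by (intro card_Un_disjoint) auto
    then have "card (C S) = 2 * card (p ` A - A)" unfolding 1 2 3 by simp
    then show ?thesis unfolding A_def .
  qed
  \<comment> \<open>For small \<open>S\<close> the sum is at most \<open>card S\<close>, and
    expansion applies. A larger \<open>S\<close> is replaced by its complement, which has the same
    boundary and the opposite sum.\<close>
  have cut: "(\<Sum>v\<in>S. x v $ k) \<le> real (card (C S))" if S: "S \<subseteq> I" for S k
  proof -
    have le: "\<bar>\<Sum>v\<in>T. x v $ k\<bar> \<le> real (card (C T))" if T: "T \<subseteq> I" "2 * card T \<le> card I" for T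
    proof -
      have "\<bar>\<Sum>v\<in>T. x v $ k\<bar> \<le> (\<Sum>v\<in>T. \<bar>x v $ k\<bar>)" by (rule sum_abs)
      also have "\<dots> \<le> (\<Sum>v\<in>T. 1)"
        using xQ T by (intro sum_mono) (auto simp: symmetric_box_mem_iff)
      also have "\<dots> = real (card T)" by simp
      also have "\<dots> \<le> real (card (C T))"
        unfolding card_C[OF T(1)] of_nat_le_iff by (rule expand[OF T])
      finally show ?thesis .
    qed
    show ?thesis
    proof (cases "2 * card S \<le> card I")
      case True
      then show ?thesis using le[OF S] by linarith
    next
      case False
      have "(\<Sum>v\<in>I. x v $ k) = 0" using sum0 by (simp add: vec_eq_iff)
      then have "(\<Sum>v\<in>S. x v $ k) = - (\<Sum>v\<in>I - S. x v $ k)"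
        using sum.subset_diff[OF S I, of "\<lambda>v. x v $ k"] by simp
      moreover have "2 * card (I - S) \<le> card I"
        using False S finite_subset[OF S I] by (simp add: card_Diff_subset)
      ultimately show ?thesis using le[of "I - S"] C_compl[OF S] by simp
    qed
  qed
  \<comment> \<open>An edge \<open>e\<close> runs from \<open>fst e\<close> to
    \<open>fst (p e)\<close>; each coordinate \<open>k\<close> gets its own real-valued
    flow.\<close>
  define flow where "flow k z \<longleftrightarrow> (\<forall>e\<in>E. \<bar>z e\<bar> \<le> 1) \<and>
    (\<forall>v\<in>I. (\<Sum>e | e \<in> E \<and> fst e = v. z e) - (\<Sum>e | e \<in> E \<and> fst (p e) = v. z e) = x v $ k)"
    for k z
  have "\<exists>z. flow k z" for k
  proof (rule ex_flow[OF I finE, of fst "\<lambda>e. fst (p e)" "\<lambda>v. x v $ k"])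
    show "fst e \<in> I" "fst (p e) \<in> I" if "e \<in> E" for e
      using that pIn[OF that] by (auto simp: E_def mem_Times_iff)
    show "(\<Sum>v\<in>I. x v $ k) = 0" using sum0 by (simp add: vec_eq_iff)
    show "(\<Sum>v\<in>S. x v $ k) \<le> real (card {e \<in> E. (fst e \<in> S) \<noteq> (fst (p e) \<in> S)})"
      if "S \<subseteq> I" for S
      using cut[OF that] by (simp only: C_def)
  next
    fix z
    assume "\<And>e. e \<in> E \<Longrightarrow> \<bar>z e\<bar> \<le> 1"
      "\<And>v. v \<in> I \<Longrightarrow> (\<Sum>e | e \<in> E \<and> fst e = v. z e) - (\<Sum>e | e \<in> E \<and> fst (p e) = v. z e) = x v $ k"
    then have "flow k z" by (simp add: flow_def)
    then show "\<exists>z. flow k z" by blast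
  qed
  then obtain z where flow: "\<And>k. flow k (z k)" using choice[of flow] by auto
  have z: "e \<in> E \<Longrightarrow> \<bar>z k e\<bar> \<le> 1"
    "v \<in> I \<Longrightarrow> (\<Sum>e | e \<in> E \<and> fst e = v. z k e) - (\<Sum>e | e \<in> E \<and> fst (p e) = v. z k e) = x v $ k"
    for k e v
    using flow[of k] by (simp_all add: flow_def)
  define Z where "Z e = (\<chi> k. z k e)" for e
  have ZQ: "Z e \<in> Q" if "e \<in> E" for e using z(1)[OF that] by (simp add: Z_def symmetric_box_mem_iff)
  \<comment> \<open>The first eight summands are the flow on the edges out of \<open>v\<close>, the
    other eight minus the flow on the edges into \<open>v\<close>: \<open>q (v, l)\<close> is the
    edge that \<open>p\<close> maps to \<open>(v, l)\<close>.\<close>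
  define w where "w v j = (if j < 8 then Z (v, j) else - Z (q (v, j - 8)))" for v j
  have split16: "(\<Sum>j<16. f (w v j)) = (\<Sum>l<8. f (Z (v, l))) + (\<Sum>l<8. f (- Z (q (v, l))))"
    for f :: "real ^ 'n \<Rightarrow> 'b::comm_monoid_add" and v
    using sum_lessThan_add[of "\<lambda>j. f (w v j)" 8 8] by (simp add: w_def)
  have qE: "q (v, l) \<in> E" if "v \<in> I" "l < 8" for v l
    using permutes_in_image[OF q, of "(v, l)"] that by (simp add: E_def)
  have sum_w: "(\<Sum>j<16. w v j) = x v" if v: "v \<in> I" for v
  proof -
    have out: "{e \<in> E. fst e = v} = Pair v ` {..<8}" using v by (auto simp: E_def)
    have inn: "{e \<in> E. fst (p e) = v} = (\<lambda>l. q (v, l)) ` {..<8}"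
    proof
      show "{e \<in> E. fst (p e) = v} \<subseteq> (\<lambda>l. q (v, l)) ` {..<8}"
      proof
        fix e assume e: "e \<in> {e \<in> E. fst (p e) = v}"
        then have "p e = (v, snd (p e))" "snd (p e) \<in> {..<8}"
          using pIn[of e] by (auto simp: E_def mem_Times_iff prod_eq_iff)
        moreover have "e = q (p e)" unfolding q_def using permutes_inverses(2)[OF pE] by simp
        ultimately show "e \<in> (\<lambda>l. q (v, l)) ` {..<8}" by (metis imageI)
      qed
      show "(\<lambda>l. q (v, l)) ` {..<8} \<subseteq> {e \<in> E. fst (p e) = v}"
        using qE[OF v] permutes_inverses(1)[OF pE] by (auto simp: q_def)
    qed
    have "inj_on (\<lambda>l. q (v, l)) {..<8}"
      using permutes_inj[OF q] by (auto intro!: inj_onI dest: injD)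
    then have "(\<Sum>l<8. z k (v, l)) - (\<Sum>l<8. z k (q (v, l))) = x v $ k" for k
      using z(2)[OF v, of k] unfolding out inn by (simp add: sum.reindex inj_on_def)
    then show ?thesis
      by (simp add: split16[of "\<lambda>y. y"] vec_eq_iff Z_def sum_negf)
  qed
  \<comment> \<open>Every edge occurs once as outgoing, with \<open>Z e\<close>, and once as
    incoming, with its negative; oddness makes the total vanish.\<close>
  have "(\<Sum>v\<in>I. \<Sum>j<16. g (w v j)) = (\<Sum>e\<in>E. g (Z e)) + (\<Sum>e\<in>E. g (- Z (q e)))"
    by (simp add: split16 sum.distrib E_def sum.cartesian_product split_def)
  also have "(\<Sum>e\<in>E. g (- Z (q e))) = (\<Sum>e\<in>E. - g (Z (q e)))"
    using permutes_in_image[OF q] by (intro sum.cong refl odd ZQ) auto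
  also have "\<dots> = - (\<Sum>e\<in>E. g (Z e))"
    using sum.permute[OF q, of "\<lambda>e. g (Z e)"] by (simp add: sum_negf o_def)
  finally have cancel: "(\<Sum>v\<in>I. \<Sum>j<16. g (w v j)) = 0" by simp
  have "(\<Sum>v\<in>I. g (x v)) \<le> (\<Sum>v\<in>I. (\<Sum>j<16. g (w v j)) + 47 * D)"
  proof (rule sum_mono)
    fix v assume v: "v \<in> I"
    have "w v j \<in> Q" if j: "j < 16" for j
    proof (cases "j < 8")
      case True
      then show ?thesis using v ZQ[of "(v, j)"] by (simp add: w_def E_def)
    next
      case False
      then show ?thesis using ZQ[OF qE[OF v, of "j - 8"]] j by (simp add: w_def symmetric_box_mem_iff)
    qed
    from abs_sum_16_diff_le[of "w v", OF this] show "g (x v) \<le> (\<Sum>j<16. g (w v j)) + 47 * D"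
      using sum_w[OF v] xQ[OF v] by (simp add: abs_le_iff)
  qed
  also have "\<dots> = 47 * D * real (card I)"
    using cancel by (simp add: sum.distrib)
  finally show ?thesis .
qed

text \<open>Reduction to uniform weights: \<open>N u\<^sub>i\<close> is rounded down to \<open>k\<^sub>i\<close>, and the missing fraction
  of \<open>x\<^sub>i\<close> is added as one more point of the cube, so that the sum stays exactly \<open>0\<close>.\<close>

lemma convex_combination_le:
  fixes x :: "'i \<Rightarrow> real ^ 'n"
  assumes P: "finite P" and u: "\<And>i. i \<in> P \<Longrightarrow> u i \<ge> 0" "(\<Sum>i\<in>P. u i) = 1"
    and xQ: "\<And>i. i \<in> P \<Longrightarrow> x i \<in> Q" and sum0: "(\<Sum>i\<in>P. u i *\<^sub>R x i) = 0"
    and B: "\<And>y. y \<in> Q \<Longrightarrow> \<bar>g y\<bar> \<le> B"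
  shows "(\<Sum>i\<in>P. u i * g (x i)) \<le> 47 * D"
proof -
  define G where "G = (\<Sum>i\<in>P. u i * g (x i))"
  define c where "c = real (card P)"
  \<comment> \<open>The right-hand side does not depend on \<open>N\<close>, so letting
    \<open>N\<close> grow forces \<open>G \<le> 47 * D\<close>.\<close>
  have bound: "real N * (G - 47 * D) \<le> 47 * D * c + 2 * B * c" for N
  proof -
    define k where "k i = nat \<lfloor>real N * u i\<rfloor>" for i
    \<comment> \<open>As \<open>j\<close> runs below \<open>Suc (k i)\<close>, the last index
      \<open>j = k i\<close> is the one carrying the fractional remainder.\<close>
    define y where "y = (\<lambda>(i, j). if j < k i then x i else (real N * u i - real (k i)) *\<^sub>R x i)"
    let ?I = "SIGMA i:P. {..<Suc (k i)}"
    have k: "real (k i) \<le> real N * u i" "real N * u i < real (k i) + 1" if "i \<in> P" for i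
      using u(1)[OF that] unfolding k_def by (simp_all add: of_nat_nat)
    have frac: "(real N * u i - real (k i)) *\<^sub>R x i \<in> Q" if "i \<in> P" for i
      using k[OF that] by (intro scaleR_mem xQ that) (simp add: abs_le_iff)
    have "(\<Sum>v\<in>?I. y v) = (\<Sum>i\<in>P. \<Sum>j<Suc (k i). y (i, j))"
      using P by (subst sum.Sigma) auto
    also have "\<dots> = (\<Sum>i\<in>P. real N *\<^sub>R (u i *\<^sub>R x i))"
      by (intro sum.cong)
        (simp_all add: y_def scaleR_left_diff_distrib sum_constant_scaleR del: sum_constant)
    also have "\<dots> = real N *\<^sub>R (\<Sum>i\<in>P. u i *\<^sub>R x i)" by (rule scaleR_sum_right[symmetric])
    finally have "(\<Sum>v\<in>?I. y v) = 0" using sum0 by simp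
    moreover have "y v \<in> Q" if "v \<in> ?I" for v
      using that xQ frac by (auto simp: y_def)
    ultimately have "(\<Sum>v\<in>?I. g (y v)) \<le> 47 * D * real (card ?I)"
      using P by (intro sum_le_of_sum_zero) auto
    also have "real (card ?I) = (\<Sum>i\<in>P. real (k i)) + c"
      using P by (simp add: c_def sum.distrib)
    also have "\<dots> \<le> (\<Sum>i\<in>P. real N * u i) + c"
      using k by (intro add_right_mono sum_mono) auto
    also have "(\<Sum>i\<in>P. real N * u i) = real N"
      using u(2) by (simp flip: sum_distrib_left)
    finally have le: "(\<Sum>v\<in>?I. g (y v)) \<le> 47 * D * (real N + c)"
      using D_nonneg by (simp add: mult_left_mono)
    have "(\<Sum>v\<in>?I. g (y v)) = (\<Sum>i\<in>P. \<Sum>j<Suc (k i). g (y (i, j)))"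
      using P by (subst sum.Sigma) auto
    also have "\<dots> = (\<Sum>i\<in>P. real (k i) * g (x i) + g ((real N * u i - real (k i)) *\<^sub>R x i))"
      by (intro sum.cong) (auto simp: y_def)
    \<comment> \<open>One \<open>B\<close> covers the fraction of \<open>g (x i)\<close> lost by
      rounding, the other the value of \<open>g\<close> at the remainder point.\<close>
    also have "\<dots> \<ge> (\<Sum>i\<in>P. real N * (u i * g (x i)) - 2 * B)"
    proof (rule sum_mono)
      fix i assume i: "i \<in> P"
      have "(real N * u i - real (k i)) * g (x i) \<le> (real N * u i - real (k i)) * B"
        using k[OF i] B[OF xQ[OF i]] by (intro mult_left_mono) auto
      also have "\<dots> \<le> 1 * B"
        using k[OF i] B[OF xQ[OF i]] by (intro mult_right_mono) auto
      finally have "(real N * u i - real (k i)) * g (x i) \<le> 1 * B" .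
      then show "real N * (u i * g (x i)) - 2 * B
          \<le> real (k i) * g (x i) + g ((real N * u i - real (k i)) *\<^sub>R x i)"
        using B[OF frac[OF i]] by (simp add: algebra_simps abs_le_iff)
    qed
    finally have "real N * G - 2 * B * c \<le> (\<Sum>v\<in>?I. g (y v))"
      by (simp add: G_def c_def sum_subtractf sum_distrib_left mult_ac)
    then show ?thesis using le by (simp add: algebra_simps)
  qed
  show ?thesis
  proof (rule ccontr)
    assume "\<not> ?thesis"
    then have "G - 47 * D > 0" by (simp add: G_def)
    then obtain N where "47 * D * c + 2 * B * c < real N * (G - 47 * D)"
      using reals_Archimedean3 by blast
    then show False using bound[of N] by simp
  qed
qed

section \<open>Separation of a point from the graph\<close>

lemma ex_linear_approx:
  assumes cont: "continuous_on Q g" and \<kappa>: "\<kappa> > 47 * D"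
  obtains a where "\<And>x. x \<in> Q \<Longrightarrow> \<bar>g x - a \<bullet> x\<bar> \<le> \<kappa>"
proof -
  define H where "H = (\<lambda>x. (x, g x)) ` Q"
  have "compact H"
    unfolding H_def by (intro compact_continuous_image continuous_intros cont compact_cbox)
  then have hull: "compact (convex hull H)" by (rule compact_convex_hull)
  have "compact (g ` Q)" by (intro compact_continuous_image cont compact_cbox)
  then obtain B where B: "\<And>y. y \<in> Q \<Longrightarrow> \<bar>g y\<bar> \<le> B"
    by (metis bounded_real compact_imp_bounded imageI)
  \<comment> \<open>A representation of this point would be a convex combination of points of the
    cube with mean 0 whose values of \<open>g\<close> average to \<open>\<kappa>\<close>, which
    exceeds \<open>47 * D\<close>.\<close>
  have "(0, \<kappa>) \<notin> convex hull H"
  proof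
    assume "(0, \<kappa>) \<in> convex hull H"
    then obtain S u where S: "finite S" "S \<subseteq> H" "\<And>v. v \<in> S \<Longrightarrow> u v \<ge> 0" "sum u S = 1"
      "(\<Sum>v\<in>S. u v *\<^sub>R v) = (0, \<kappa>)"
      unfolding convex_hull_explicit by auto
    have H: "fst v \<in> Q" "snd v = g (fst v)" if "v \<in> S" for v
      using S(2) that by (auto simp: H_def)
    have "(\<Sum>v\<in>S. u v *\<^sub>R fst v) = 0"
      using arg_cong[OF S(5), of fst] by (simp add: fst_sum)
    then have "(\<Sum>v\<in>S. u v * g (fst v)) \<le> 47 * D"
      using S H B by (intro convex_combination_le) auto
    moreover have "(\<Sum>v\<in>S. u v * g (fst v)) = \<kappa>"
      using arg_cong[OF S(5), of snd] H by (simp add: snd_sum cong: sum.cong)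
    ultimately show False using \<kappa> by simp
  qed
  then obtain ab \<beta> where "ab \<bullet> (0, \<kappa>) < \<beta>" "\<forall>v\<in>convex hull H. ab \<bullet> v > \<beta>"
    using separating_hyperplane_closed_point[OF convex_convex_hull compact_imp_closed[OF hull]]
    by blast
  moreover obtain a b where "ab = (a, b)" by (cases ab)
  moreover have "(x, g x) \<in> convex hull H" if "x \<in> Q" for x
    using that by (intro hull_inc) (simp add: H_def)
  ultimately have ab: "b * \<kappa> < \<beta>" "\<And>x. x \<in> Q \<Longrightarrow> a \<bullet> x + b * g x > \<beta>"
    by force+
  \<comment> \<open>The graph passes through the origin, so \<open>\<beta>\<close> and with it
    \<open>b * \<kappa>\<close> are negative. Hence \<open>b < 0\<close>: the hyperplane is not
    vertical and can be solved for \<open>g\<close>.\<close>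
  have "\<beta> < 0" using ab(2)[OF zero_mem] by (simp add: g_zero)
  then have b: "b < 0"
    using ab(1) \<kappa> D_nonneg by (smt (verit) mult_nonneg_nonneg)
  have upper: "g x - (- (1 / b) *\<^sub>R a) \<bullet> x \<le> \<kappa>" if "x \<in> Q" for x
  proof -
    have "b * (g x + (1 / b) * (a \<bullet> x)) > b * \<kappa>"
      using ab(1) ab(2)[OF that] b by (simp add: algebra_simps)
    then show ?thesis using b by (simp add: mult_less_cancel_left)
  qed
  show thesis
  proof (rule that)
    \<comment> \<open>The one-sided bound at \<open>x\<close> and at \<open>- x\<close> gives both
      sides, since \<open>g\<close> is odd.\<close>
    fix x assume x: "x \<in> Q"
    then have "- x \<in> Q" by (simp add: symmetric_box_mem_iff)
    from upper[OF this] upper[OF x] odd[OF x]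
    show "\<bar>g x - (- (1 / b) *\<^sub>R a) \<bullet> x\<bar> \<le> \<kappa>" by (simp add: abs_le_iff)
  qed
qed

end

section \<open>The Whitney constant of the cube\<close>

lemma second_difference_upper:
  fixes f :: "real ^ 'n::finite \<Rightarrow> real"
  assumes "continuous_on unit_cube f" "x \<in> unit_cube" "y \<in> unit_cube"
  shows "\<bar>f x + f y - 2 * f ((1 / 2) *\<^sub>R (x + y))\<bar> \<le> second_difference f"
proof -
  have "compact (f ` unit_cube)"
    using assms(1) by (intro compact_continuous_image) (auto simp: unit_cube_def)
  then obtain B where B: "\<And>x. x \<in> unit_cube \<Longrightarrow> \<bar>f x\<bar> \<le> B"
    by (metis bounded_real compact_imp_bounded imageI)
  have mid: "(1 / 2) *\<^sub>R (u + v) \<in> unit_cube" if "u \<in> unit_cube" "v \<in> unit_cube" for u v :: "real ^ 'n"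
    using that convexD[of "unit_cube :: (real ^ 'n) set" u v "1/2" "1/2"]
    by (simp add: unit_cube_def scaleR_add_right)
  have "bdd_above ((\<lambda>(u, v). \<bar>f u + f v - 2 * f ((1 / 2) *\<^sub>R (u + v))\<bar>) ` (unit_cube \<times> unit_cube))"
  proof (rule bdd_aboveI2[where M = "4 * B"], clarify)
    fix u v :: "real ^ 'n"
    assume "u \<in> unit_cube" "v \<in> unit_cube"
    then show "\<bar>f u + f v - 2 * f ((1 / 2) *\<^sub>R (u + v))\<bar> \<le> 4 * B"
      using B[of u] B[of v] B[OF mid, of u v] by linarith
  qed
  from cSUP_upper[OF _ this, of "(x, y)"] assms(2,3) show ?thesis
    by (simp add: second_difference_def)
qed

lemma linear_approx_error_le:
  fixes f :: "real ^ 'n::finite \<Rightarrow> real"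
  assumes f: "continuous_on unit_cube f" and L: "L \<in> linear_polys"
    and le: "\<And>x. x \<in> unit_cube \<Longrightarrow> \<bar>f x - L x\<bar> \<le> \<epsilon>"
  shows "linear_approx_error f \<le> \<epsilon>"
proof -
  have zero: "0 \<in> (unit_cube :: (real ^ 'n) set)" by (simp add: unit_cube_def mem_box_cart)
  \<comment> \<open>The infimum of reals is a lower bound only for a family bounded below; 0 is such
    a bound once compactness makes each supremum genuine.\<close>
  have "(SUP x\<in>unit_cube. \<bar>f x - K x\<bar>) \<ge> 0" if K: "K \<in> linear_polys" for K
  proof -
    have "continuous_on unit_cube K"
      using K by (auto simp: linear_polys_def intro!: continuous_intros)
    then have "compact ((\<lambda>x. \<bar>f x - K x\<bar>) ` unit_cube)"
      using f by (intro compact_continuous_image continuous_intros) (auto simp: unit_cube_def)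
    then have "bdd_above ((\<lambda>x. \<bar>f x - K x\<bar>) ` unit_cube)"
      by (intro bounded_imp_bdd_above compact_imp_bounded)
    from cSUP_upper[OF zero this] show ?thesis by simp
  qed
  then have "bdd_below ((\<lambda>K. SUP x\<in>unit_cube. \<bar>f x - K x\<bar>) ` linear_polys)"
    by (rule bdd_belowI2)
  then have "linear_approx_error f \<le> (SUP x\<in>unit_cube. \<bar>f x - L x\<bar>)"
    unfolding linear_approx_error_def using L by (rule cINF_lower)
  also have "\<dots> \<le> \<epsilon>" using zero le by (intro cSUP_least) auto
  finally show ?thesis .
qed

text \<open>The odd part of \<open>f\<close> about the centre costs \<open>47 * D\<close>, and the
  even part differs from the value at the centre by at most \<open>D / 2\<close>.\<close>

lemma whitney_bound_95_2: "whitney_bound TYPE('n::finite) (95 / 2)"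
  unfolding whitney_bound_def
proof (intro allI impI)
  fix f :: "real ^ 'n \<Rightarrow> real"
  assume f: "continuous_on unit_cube f"
  define D where "D = second_difference f"
  \<comment> \<open>\<open>\<tau>\<close> maps [-1,1]^d to the unit cube and turns \<open>x\<close>
    to \<open>- x\<close> into the reflection \<open>y\<close> to \<open>1 - y\<close>.\<close>
  define \<tau> where "\<tau> x = (1 / 2) *\<^sub>R (1 + x)" for x :: "real ^ 'n"
  define g where "g x = (f (\<tau> x) - f (\<tau> (- x))) / 2" for x
  have \<tau>_mem: "\<tau> x \<in> unit_cube" "\<tau> (- x) \<in> unit_cube" if "x \<in> cbox (-1) 1" for x
    using that by (auto simp: \<tau>_def unit_cube_def symmetric_box_mem_iff mem_box_cart abs_le_iff)
      (smt (verit))+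
  have \<tau>_mid: "\<tau> ((1 / 2) *\<^sub>R (x + y)) = (1 / 2) *\<^sub>R (\<tau> x + \<tau> y)" for x y
    by (simp add: \<tau>_def vec_eq_iff field_simps)
  interpret odd_almost_affine g D
  proof
    fix x y :: "real ^ 'n" assume x: "x \<in> cbox (-1) 1"
    show "g (- x) = - g x" by (simp add: g_def field_simps)
    assume y: "y \<in> cbox (-1) 1"
    have "\<tau> (- ((1 / 2) *\<^sub>R (x + y))) = (1 / 2) *\<^sub>R (\<tau> (- x) + \<tau> (- y))"
      using \<tau>_mid[of "- x" "- y"] by (simp add: scaleR_right_diff_distrib scaleR_add_right)
    \<comment> \<open>A second difference of \<open>g\<close> is half the difference of two second
      differences of \<open>f\<close>, so the bound \<open>D\<close> is inherited.\<close>
    then have "g x + g y - 2 * g ((1 / 2) *\<^sub>R (x + y)) =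
      ((f (\<tau> x) + f (\<tau> y) - 2 * f ((1 / 2) *\<^sub>R (\<tau> x + \<tau> y)))
        - (f (\<tau> (- x)) + f (\<tau> (- y)) - 2 * f ((1 / 2) *\<^sub>R (\<tau> (- x) + \<tau> (- y))))) / 2"
      unfolding g_def \<tau>_mid by (simp add: field_simps)
    moreover have "\<bar>(u - v) / 2\<bar> \<le> D" if "\<bar>u\<bar> \<le> D" "\<bar>v\<bar> \<le> D" for u v
      using that by (simp add: abs_le_iff)
    ultimately show "\<bar>g x + g y - 2 * g ((1 / 2) *\<^sub>R (x + y))\<bar> \<le> D"
      using second_difference_upper[OF f \<tau>_mem(1)[OF x] \<tau>_mem(1)[OF y]]
        second_difference_upper[OF f \<tau>_mem(2)[OF x] \<tau>_mem(2)[OF y]]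
      by (simp only: D_def)
  qed
  have "continuous_on Q (\<lambda>x. f (\<tau> x))"
    by (rule continuous_on_compose2[OF f])
      (auto simp: \<tau>_mem, auto simp: \<tau>_def intro!: continuous_intros)
  moreover have "continuous_on Q (\<lambda>x. f (\<tau> (- x)))"
    by (rule continuous_on_compose2[OF f])
      (auto simp: \<tau>_mem, auto simp: \<tau>_def intro!: continuous_intros)
  ultimately have cont: "continuous_on Q g"
    unfolding g_def by (intro continuous_intros) auto
  \<comment> \<open>The slack \<open>e\<close> meets the strict inequality required for separation
    and is removed at the end.\<close>
  have "linear_approx_error f \<le> 95 / 2 * D + e" if e: "e > 0" for e
  proof -
    obtain a where a: "\<And>x. x \<in> Q \<Longrightarrow> \<bar>g x - a \<bullet> x\<bar> \<le> 47 * D + e"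
      using ex_linear_approx[OF cont, of "47 * D + e"] e by auto
    define c where "c = f ((1 / 2) *\<^sub>R 1)"
    have "(\<lambda>y. c + a \<bullet> (2 *\<^sub>R y - 1)) \<in> linear_polys"
      unfolding linear_polys_def
      by (rule CollectI, intro exI[of _ "c - a \<bullet> 1"] exI[of _ "2 *\<^sub>R a"])
        (simp add: inner_vec_def fun_eq_iff algebra_simps sum_subtractf sum.distrib sum_distrib_left)
    moreover have "\<bar>f y - (c + a \<bullet> (2 *\<^sub>R y - 1))\<bar> \<le> 95 / 2 * D + e" if y: "y \<in> unit_cube" for y
    proof -
      have x: "2 *\<^sub>R y - 1 \<in> Q" and y': "1 - y \<in> unit_cube"
        using y by (auto simp: unit_cube_def mem_box_cart)
      have "\<tau> (2 *\<^sub>R y - 1) = y" "\<tau> (- (2 *\<^sub>R y - 1)) = 1 - y"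
        by (auto simp: \<tau>_def vec_eq_iff field_simps)
      then have "g (2 *\<^sub>R y - 1) = (f y - f (1 - y)) / 2" by (simp only: g_def)
      moreover have "\<bar>f y + f (1 - y) - 2 * c\<bar> \<le> D"
        using second_difference_upper[OF f y y'] by (simp add: c_def D_def)
      ultimately show ?thesis
        using a[OF x] by (simp add: abs_le_iff)
    qed
    ultimately show ?thesis by (rule linear_approx_error_le[OF f])
  qed
  then show "linear_approx_error f \<le> 95 / 2 * second_difference f"
    unfolding D_def by (rule field_le_epsilon)
qed

theorem theorem1p3:
  "w2 TYPE('n::finite) < 73"
proof -
  have "w2 TYPE('n) \<le> ereal (95 / 2)"
    unfolding w2_def using whitney_bound_95_2 by (intro Inf_lower) auto
  also have "\<dots> < 73" by simp
  finally show ?thesis .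
qed

end
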